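(* (First interlacing property.) Let $n$ be a positive integer and let $j$ be an integer with $1\le j\le n-4$. Let $Q_j$ and $Q_{j+1}$ be the polynomials (depending on $n$) defined in the context. Let $0<x_1<\cdots<x_j$ be the roots of $Q_j$ and $0<y_1<\cdots<y_{j+1}$ the roots of $Q_{j+1}$. Then $$y_1<x_1<y_2<x_2<\cdots<y_j<x_j<y_{j+1}.$$
   Context: Fix $n$. For polynomials $P=\sum_{j=0}^n p_jx^j$ and $Q=\sum_{j=0}^n q_jx^j$, the Schur-Szegő composition (with respect to degree $n$) is $P\ast Q:=\sum_{j=0}^n p_jq_jx^j/\binom{n}{j}$; it is associative and commutative, and for several polynomials it is defined by iteration. For $a\in\mathbb{C}$ put $K_a:=(x+1)^{n-1}(x+a)$. It is known that every monic complex polynomial $P$ of degree $n$ with $P(-1)=0$ can be written as $P=K_{a_1}\ast\cdots\ast K_{a_{n-1}}$ with $a_1,\dots,a_{n-1}\in\mathbb{C}$ unique up to permutation. Write $P=(x+1)(x^{n-1}+c_1x^{n-2}+\cdots+c_{n-1})$ and let $\sigma_j$ be the $j$th elementary symmetric polynomial of $a_1,\dots,a_{n-1}$. It is known that $(c_1,\dots,c_{n-1})\mapsto(\sigma_1,\dots,\sigma_{n-1})$ is an affine map; it extends to a linear map $(c_0,c_1,\dots,c_{n-1})\mapsto(\sigma_0,\sigma_1,\dots,\sigma_{n-1})$ with $\sigma_0=c_0$. We regard it as a linear map $\Phi$ on the space of polynomials of degree $\le n$ vanishing at $-1$: $\Phi\big((x+1)\sum_{i=0}^{n-1}c_ix^{n-1-i}\big)=(x+1)\sum_{i=0}^{n-1}\sigma_ix^{n-1-i}$.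 Thus $\Phi$ is the unique linear map of this space with $\Phi(K_{a_1}\ast\cdots\ast K_{a_{n-1}})=(x+1)\prod_{i=1}^{n-1}(x+a_i)$ for all $a_1,\dots,a_{n-1}$. It is known that for $1\le j\le n-3$ the number $\frac{n^{j+1}}{(n-1)(n-2)\cdots(n-j-1)}$ is an eigenvalue of $\Phi$ whose eigenspace is one-dimensional and spanned by a polynomial of the form $x(x+1)^{n-2-j}Q_j(x)$ with $Q_j$ real, monic of degree $j$; this defines $Q_j$. It is known that all roots of $Q_j$ are real, positive and distinct and that $x^jQ_j(1/x)=\pm Q_j(x)$. *)

theory Defs
  imports Complex_Main "HOL-Computational_Algebra.Polynomial"
begin

definition schur_szego :: "nat \<Rightarrow> complex poly \<Rightarrow> complex poly \<Rightarrow> complex poly" where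
  "schur_szego n P Q = (\<Sum>j\<le>n. monom (coeff P j * coeff Q j / of_nat (n choose j)) j)"

definition KP :: "nat \<Rightarrow> complex \<Rightarrow> complex poly" where
  "KP n a = [:1, 1:] ^ (n - 1) * [:a, 1:]"

(* The iteration starts from (x+1)^n, the neutral element of the composition
   on polynomials of degree at most n (see schur_szego_neutral). *)
definition schur_szego_list :: "nat \<Rightarrow> complex poly list \<Rightarrow> complex poly" where
  "schur_szego_list n Ps = foldr (schur_szego n) Ps ([:1, 1:] ^ n)"

lemma coeff_schur_szego:
  "coeff (schur_szego n P Q) k =
     (if k \<le> n then coeff P k * coeff Q k / of_nat (n choose k) else 0)"
  by (simp add: schur_szego_def coeff_sum)

lemma schur_szego_neutral:
  assumes "degree P \<le> n"
  shows "schur_szego n P ([:1, 1:] ^ n) = P"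
proof (rule poly_eqI)
  fix k
  have "coeff P k = 0" if "n < k"
    using assms that by (simp add: coeff_eq_0)
  then show "coeff (schur_szego n P ([:1, 1:] ^ n)) k = coeff P k"
    by (auto simp: coeff_schur_szego coeff_linear_power coeff_linear_poly_power)
qed

definition VP :: "nat \<Rightarrow> complex poly set" where
  "VP n = {p. degree p \<le> n \<and> poly p (- 1) = 0}"

(* Phi is a linear map VP n => VP n with the property that characterises it uniquely;
   its values outside VP n are irrelevant. *)
definition is_Phi :: "nat \<Rightarrow> (complex poly \<Rightarrow> complex poly) \<Rightarrow> bool" where
  "is_Phi n \<Phi> \<longleftrightarrow>
     (\<forall>p\<in>VP n. \<Phi> p \<in> VP n) \<and>
     (\<forall>p\<in>VP n. \<forall>q\<in>VP n. \<Phi> (p + q) = \<Phi> p + \<Phi> q) \<and>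
     (\<forall>c. \<forall>p\<in>VP n. \<Phi> (smult c p) = smult c (\<Phi> p)) \<and>
     (\<forall>as. length as = n - 1 \<longrightarrow>
        \<Phi> (schur_szego_list n (map (KP n) as)) = [:1, 1:] * (\<Prod>a\<leftarrow>as. [:a, 1:]))"

definition eigenspace ::
    "nat \<Rightarrow> (complex poly \<Rightarrow> complex poly) \<Rightarrow> complex \<Rightarrow> complex poly set" where
  "eigenspace n \<Phi> l = {p \<in> VP n. \<Phi> p = smult l p}"

definition eigval :: "nat \<Rightarrow> nat \<Rightarrow> complex" where
  "eigval n j = of_nat n ^ (j + 1) / (\<Prod>i=1..j+1. of_nat n - of_nat i)"

(* Intended for 1 <= j <= n - 3. The factor [:0, 1:] is x; the right-hand side of the
   last conjunct is the complex line spanned by x (x+1)^(n-2-j) Q(x). *)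
definition is_Q ::
    "nat \<Rightarrow> (complex poly \<Rightarrow> complex poly) \<Rightarrow> nat \<Rightarrow> real poly \<Rightarrow> bool" where
  "is_Q n \<Phi> j Q \<longleftrightarrow>
     degree Q = j \<and> lead_coeff Q = 1 \<and>
     eigenspace n \<Phi> (eigval n j) =
       range (\<lambda>c. smult c ([:0, 1:] * [:1, 1:] ^ (n - 2 - j) * map_poly of_real Q))"

end

theory Submission
  imports Defs "HOL-Computational_Algebra.Fundamental_Theorem_Algebra"
begin

text \<open>
  If \<open>P\<close> has coefficients \<open>(n choose i) * g i\<close> for a polynomial \<open>g\<close> of degree less than \<open>n\<close>, then
  \<open>\<Phi> P x = (x + 1) ^ n * g (n * x / (x + 1))\<close>: for compositions of the \<open>K\<^sub>a\<close> this is read off the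
  factors, and the general case follows by linearity (\<open>\<Phi>\<close> is a conjugate of the inverse of the
  Bernstein operator). So the \<open>i\<close>-th coefficient of \<open>P\<close> is a positive multiple of the value of
  \<open>\<Phi> P\<close> at \<open>i / (n - i)\<close>, and by Descartes' rule of signs \<open>\<Phi> P\<close> has at least as many sign changes
  on the positive axis as \<open>P\<close> has positive roots.

  Let \<open>e\<close> and \<open>e'\<close> be the eigenvectors belonging to \<open>Q\<^sub>j\<close> and \<open>Q\<^bsub>j+1\<^esub>\<close>. Writing a combination
  of \<open>e\<close> and \<open>e'\<close> as a multiple of \<open>\<Phi>\<^sup>k\<close> of another one that is close to \<open>e\<close> shows that it has
  at least \<open>j\<close> sign changes. Since \<open>c (x + 1) Q\<^sub>j + d Q\<^bsub>j+1\<^esub>\<close> has degree at most \<open>j + 1\<close>, it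
  has no double root. Hence the Wronskian of \<open>(x + 1) Q\<^sub>j\<close> and \<open>Q\<^bsub>j+1\<^esub>\<close> does not vanish,
  and by Rolle there is a root of \<open>Q\<^sub>j\<close> between any two roots of \<open>Q\<^bsub>j+1\<^esub>\<close>.
\<close>

subsection \<open>Values of \<open>\<Phi>\<close>\<close>

text \<open>A composition of polynomials \<open>KP n a\<close> has this form with \<open>g\<close> a
  product of linear polynomials in the index \<open>i\<close>. In this form \<open>\<Phi>\<close>
  can be computed.\<close>

definition binomial_transform :: "nat \<Rightarrow> complex poly \<Rightarrow> complex poly" where
  "binomial_transform n g = (\<Sum>i\<le>n. monom (of_nat (n choose i) * poly g (of_nat i)) i)"

lemma coeff_binomial_transform:
  "coeff (binomial_transform n g) i = of_nat (n choose i) * poly g (of_nat i)"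
  by (simp add: binomial_transform_def coeff_sum)

lemma binomial_transform_add:
  "binomial_transform n (g + h) = binomial_transform n g + binomial_transform n h"
  by (rule poly_eqI) (simp add: coeff_binomial_transform algebra_simps)

lemma binomial_transform_smult:
  "binomial_transform n (smult c g) = smult c (binomial_transform n g)"
  by (rule poly_eqI) (simp add: coeff_binomial_transform)

text \<open>The binomial coefficient "z choose k" as a polynomial in z. These form a basis on which
  the transform is explicit.\<close>

definition binomial_poly :: "nat \<Rightarrow> complex poly" where
  "binomial_poly k = smult (1 / fact k) (\<Prod>i<k. [:- of_nat i, 1:])"

lemma poly_binomial_poly: "poly (binomial_poly k) (of_nat i) = of_nat (i choose k)"
proof -
  have "(of_nat (i choose k) :: complex) = of_nat i gchoose k"
    by (simp add: binomial_gbinomial)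
  then show ?thesis
    by (simp add: binomial_poly_def poly_prod gbinomial_prod_rev lessThan_atLeast0)
qed

lemma degree_binomial_poly: "degree (binomial_poly k) = k"
  by (simp add: binomial_poly_def degree_prod_sum_eq)

lemma binomial_transform_binomial_poly:
  assumes "k \<le> n"
  shows "binomial_transform n (binomial_poly k)
    = smult (of_nat (n choose k)) (monom 1 k * [:1, 1:] ^ (n - k))"
proof (rule poly_eqI)
  fix i
  have deg: "degree ([:1, 1:] ^ (n - k) :: complex poly) = n - k"
    by (simp add: degree_power_eq)
  show "coeff (binomial_transform n (binomial_poly k)) i
    = coeff (smult (of_nat (n choose k)) (monom 1 k * [:1, 1:] ^ (n - k))) i"
  proof (cases "k \<le> i \<and> i \<le> n")
    case True
    then have "(n choose i) * (i choose k) = (n choose k) * (n - k choose (i - k))"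
      by (intro choose_mult) auto
    then have "(of_nat (n choose i) * of_nat (i choose k) :: complex)
        = of_nat (n choose k) * of_nat (n - k choose (i - k))"
      by (metis of_nat_mult)
    with True show ?thesis
      by (simp add: coeff_binomial_transform poly_binomial_poly coeff_monom_mult
          coeff_linear_poly_power diff_le_mono)
  next
    case False
    then show ?thesis
      using assms deg
      by (auto simp: coeff_binomial_transform poly_binomial_poly coeff_monom_mult coeff_eq_0)
  qed
qed

lemma degree_binomial_transform: "degree (binomial_transform n g) \<le> n"
  by (rule degree_le) (simp add: coeff_binomial_transform)

text \<open>In the basis \<open>binomial_poly k\<close> with \<open>k < n\<close>, every image
  contains a factor \<open>[:1, 1:] ^ (n - k)\<close> of positive exponent. The induction strips off
  the leading basis element.\<close>

lemma binomial_transform_in_VP: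
  assumes "degree g < n"
  shows "binomial_transform n g \<in> VP n"
proof -
  have "poly (binomial_transform n g) (- 1) = 0" if "degree g \<le> m" "m < n" for m
    using that
  proof (induction m arbitrary: g)
    case 0
    then obtain c where "g = [:c:]"
      by (metis degree_0_id le_zero_eq degree_eq_zeroE)
    then have "g = smult c (binomial_poly 0)"
      by (simp add: binomial_poly_def)
    with 0 show ?case
      by (simp add: binomial_transform_smult binomial_transform_binomial_poly zero_power)
  next
    case (Suc m)
    define c where "c = coeff g (Suc m) / lead_coeff (binomial_poly (Suc m))"
    define h where "h = g - smult c (binomial_poly (Suc m))"
    have nz: "lead_coeff (binomial_poly (Suc m)) \<noteq> 0"
      using degree_binomial_poly[of "Suc m"] by (metis degree_0 leading_coeff_0_iff nat.distinct(1))
    have "degree h \<le> m"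
    proof (rule degree_le, intro allI impI)
      fix i assume "m < i"
      show "coeff h i = 0"
      proof (cases "i = Suc m")
        case True
        then show ?thesis
          using nz by (simp add: h_def c_def degree_binomial_poly)
      next
        case False
        with \<open>m < i\<close> Suc.prems show ?thesis
          by (simp add: h_def coeff_eq_0 degree_binomial_poly)
      qed
    qed
    then have "poly (binomial_transform n h) (- 1) = 0"
      using Suc by simp
    moreover have "g = h + smult c (binomial_poly (Suc m))"
      by (simp add: h_def)
    ultimately show ?case
      using Suc.prems
      by (simp add: binomial_transform_add binomial_transform_smult
          binomial_transform_binomial_poly)
  qed
  from this[of "degree g"] assms show ?thesis
    by (simp add: VP_def degree_binomial_transform)
qed

text \<open>After \<open>[:1, 1:]\<close> is split off, the cofactor is cleared from its lowest
  coefficient upwards. The monomial factor in \<open>ex\<close> records how many coefficients are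
  already gone.\<close>

lemma binomial_transform_onto_VP:
  assumes "0 < n" and P: "P \<in> VP n"
  obtains g where "degree g < n" and "binomial_transform n g = P"
proof -
  have ex: "\<exists>g. degree g < n \<and> binomial_transform n g = monom 1 (n - 1 - m) * ([:1, 1:] * R)"
    if "m < n" "degree R \<le> m" for m R
    using that
  proof (induction m arbitrary: R)
    case 0
    then obtain c where "R = [:c:]"
      by (metis le_zero_eq degree_eq_zeroE)
    then have R: "[:1, 1:] * R = smult c ([:1, 1:] ^ (n - (n - 1)))"
      using \<open>0 < n\<close> by simp
    have "(of_nat (n choose (n - 1)) :: complex) \<noteq> 0"
      by simp
    then have "c / of_nat (n choose (n - 1)) * of_nat (n choose (n - 1)) = c"
      by (metis nonzero_mult_div_cancel_right times_divide_eq_left)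
    then have "binomial_transform n (smult (c / of_nat (n choose (n - 1))) (binomial_poly (n - 1)))
        = monom 1 (n - 1) * ([:1, 1:] * R)"
      unfolding R binomial_transform_smult binomial_transform_binomial_poly[OF diff_le_self]
      by (simp only: smult_smult mult_smult_right)
    moreover have "degree (smult (c / of_nat (n choose (n - 1))) (binomial_poly (n - 1))) < n"
      using \<open>0 < n\<close> by (simp add: degree_binomial_poly)
    ultimately show ?case
      unfolding diff_zero by blast
next
    case (Suc m)
    define c where "c = coeff R 0"
    define k where "k = n - 1 - Suc m"
    have k: "k < n" "n - k = Suc (Suc m)" "n - 1 - m = Suc k"
      using Suc.prems by (auto simp: k_def)
    \<comment> \<open>Subtracting this power kills the constant coefficient, so \<open>S\<close> is
      divisible by x. The power itself comes from \<open>binomial_poly k\<close>, since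
      \<open>n - k\<close> is \<open>m + 2\<close>.\<close>
    define S where "S = R - smult c ([:1, 1:] ^ Suc m)"
    have "coeff S 0 = 0"
      by (simp add: S_def c_def coeff_linear_poly_power del: power_Suc)
    then obtain T where T: "S = pCons 0 T"
      by (metis pCons_cases coeff_pCons_0)
    have "degree S \<le> Suc m"
      unfolding S_def
      by (intro degree_diff_le Suc.prems order.trans[OF degree_smult_le])
        (simp add: degree_power_eq del: power_Suc)
    then have "degree T \<le> m"
      using T by (auto split: if_splits)
    with Suc obtain g where g: "degree g < n"
      "binomial_transform n g = monom 1 (n - 1 - m) * ([:1, 1:] * T)"
      by (metis Suc_lessD)
    define h where "h = g + smult (c / of_nat (n choose k)) (binomial_poly k)"
    have "degree h < n"
      unfolding h_def using g k
      by (intro degree_add_less) (auto simp: degree_binomial_poly intro: le_less_trans[OF degree_smult_le])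
    moreover have "binomial_transform n h = monom 1 k * ([:1, 1:] * R)"
    proof -
      have "c / of_nat (n choose k) * of_nat (n choose k) = c"
        using k by simp
      then have "binomial_transform n h
          = monom 1 (Suc k) * ([:1, 1:] * T) + smult c (monom 1 k * [:1, 1:] ^ Suc (Suc m))"
        unfolding h_def binomial_transform_add binomial_transform_smult g(2) k(3)
          binomial_transform_binomial_poly[OF less_imp_le[OF k(1)]] k(2) smult_smult
        by simp
      also have "monom 1 (Suc k) * ([:1, 1:] * T) = monom 1 k * ([:1, 1:] * S)"
        by (simp add: T monom_Suc)
      also have "smult c (monom 1 k * [:1, 1:] ^ Suc (Suc m))
          = monom 1 k * ([:1, 1:] * smult c ([:1, 1:] ^ Suc m))"
        by (simp only: mult_smult_right power_Suc)
      also have "monom 1 k * ([:1, 1:] * S) + \<dots>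
          = monom 1 k * ([:1, 1:] * (S + smult c ([:1, 1:] ^ Suc m)))"
        by (simp only: distrib_left)
      also have "S + smult c ([:1, 1:] ^ Suc m) = R"
        by (simp add: S_def)
      finally show ?thesis .
    qed
    ultimately show ?case
      unfolding k_def by blast
  qed
  have "[:1, 1:] dvd P"
    using P poly_eq_0_iff_dvd[of P "- 1"] by (simp add: VP_def)
  then obtain R where R: "P = [:1, 1:] * R"
    by (elim dvdE)
  have "degree R \<le> n - 1"
  proof (cases "R = 0")
    case False
    then have "degree P = Suc (degree R)"
      by (simp add: R degree_mult_eq del: mult_pCons_left)
    with P show ?thesis
      by (auto simp: VP_def)
  qed simp
  with ex[of "n - 1" R] \<open>0 < n\<close> R that show ?thesis
    by auto
qed

text \<open>Each \<open>KP n a\<close> has coefficients \<open>n choose i\<close> times a linear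
  function of \<open>i\<close>. Every composition multiplies the linear functions and cancels one of
  the two binomials.\<close>

lemma coeff_schur_szego_list_KP:
  assumes "0 < n" "i \<le> n"
  shows "coeff (schur_szego_list n (map (KP n) as)) i
    = of_nat (n choose i) * (\<Prod>a\<leftarrow>as. a + (1 - a) / of_nat n * of_nat i)"
proof (induction as)
  case Nil
  from assms show ?case
    by (simp add: schur_szego_list_def coeff_linear_poly_power)
next
  case (Cons a as)
  have nz: "(of_nat n :: complex) \<noteq> 0" "(of_nat (n choose i) :: complex) \<noteq> 0"
    using assms by auto
  have KP: "coeff (KP n a) i = of_nat (n choose i) * (a + (1 - a) / of_nat n * of_nat i)"
  proof -
    obtain m where m: "n = Suc m"
      using assms by (cases n) auto
    have deg: "degree ([:1, 1:] ^ m :: complex poly) = m"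
      by (simp add: degree_power_eq)
    have c: "coeff ([:1, 1:] ^ m) k = (of_nat (m choose k) :: complex)" for k
      by (cases "k \<le> m") (auto simp: coeff_linear_poly_power coeff_eq_0 deg)
    show ?thesis
    proof (cases i)
      case 0
      then show ?thesis
        by (simp add: KP_def m c)
    next
      case (Suc k)
      have *: "of_nat (Suc k) * (of_nat (Suc m choose Suc k) :: complex)
          = of_nat (Suc m) * of_nat (m choose k)"
        by (metis Suc_times_binomial_eq of_nat_mult mult.commute)
      have "coeff (KP n a) i = of_nat (m choose k) + a * of_nat (m choose Suc k)"
        by (simp add: KP_def m c Suc)
      also have "(of_nat (m choose Suc k) :: complex) = of_nat (n choose i) - of_nat (m choose k)"
        by (simp add: m Suc)
      also have "(of_nat (m choose k) :: complex) = of_nat (n choose i) * of_nat i / of_nat n"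
        using * nz by (simp add: m Suc field_simps del: binomial_Suc_Suc of_nat_Suc)
      finally show ?thesis
        using nz by (simp add: field_simps)
    qed
  qed
  have "schur_szego_list n (map (KP n) (a # as))
      = schur_szego n (KP n a) (schur_szego_list n (map (KP n) as))"
    by (simp add: schur_szego_list_def)
  then show ?case
    using nz assms by (simp add: coeff_schur_szego Cons KP)
qed

lemma poly_prod_list_map:
  "poly (\<Prod>x\<leftarrow>xs. f x) z = (\<Prod>x\<leftarrow>xs. poly (f x) z)"
  by (induction xs) auto

text \<open>\<open>[:a, (1 - a) / z:]\<close> is the general polynomial of degree at most 1 with
  value 1 at \<open>z\<close>. With \<open>z = n\<close> these are the factors contributed by the
  \<open>KP n a\<close>.\<close>

lemma linear_factors_normalized_at:
  fixes g :: "complex poly"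
  assumes "degree g \<le> m" and "poly g z = 1" and "z \<noteq> 0"
  shows "\<exists>as. length as = m \<and> g = (\<Prod>a\<leftarrow>as. [:a, (1 - a) / z:])"
  using assms
proof (induction m arbitrary: g)
  case 0
  then obtain c where "g = [:c:]"
    by (metis le_zero_eq degree_eq_zeroE)
  with 0 show ?case
    by simp
next
  case (Suc m)
  show ?case
  proof (cases "degree g \<le> m")
    case True
    with Suc obtain as where "length as = m" "g = (\<Prod>a\<leftarrow>as. [:a, (1 - a) / z:])"
      by blast
    then show ?thesis
      \<comment> \<open>The parameter 1 gives the constant factor 1, which pads the list when the
        degree is too small.\<close>
      by (intro exI[of _ "1 # as"]) (simp add: one_pCons[symmetric])
  next
    case False
    then have "\<not> constant (poly g)"
      by (simp add: constant_degree)
    then obtain r where "poly g r = 0"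
      using fundamental_theorem_of_algebra by blast
    then obtain h where h: "g = [:- r, 1:] * h"
      by (auto simp: poly_eq_0_iff_dvd)
    have nz: "z - r \<noteq> 0"
      using Suc.prems h by auto
    have "h \<noteq> 0"
      using h Suc.prems by auto
    then have "degree g = Suc (degree h)"
      by (simp add: h degree_mult_eq del: mult_pCons_left)
    then have "degree (smult (z - r) h) \<le> m"
      using Suc.prems nz by simp
    moreover have "poly (smult (z - r) h) z = 1"
      using Suc.prems by (simp add: h algebra_simps)
    ultimately obtain as where as: "length as = m" "smult (z - r) h = (\<Prod>a\<leftarrow>as. [:a, (1 - a) / z:])"
      using Suc by blast
    \<comment> \<open>This is the value at 0 of the root factor rescaled to equal 1 at
      \<open>z\<close>.\<close>
    define b where "b = - r / (z - r)"
    have "(1 - b) / z = 1 / (z - r)"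
      using nz \<open>z \<noteq> 0\<close> by (simp add: b_def field_simps)
    then have "[:- r, 1:] = smult (z - r) [:b, (1 - b) / z:]"
      using nz by (simp add: b_def)
    then have "g = [:b, (1 - b) / z:] * smult (z - r) h"
      by (simp only: h mult_smult_left mult_smult_right)
    with as show ?thesis
      by (intro exI[of _ "b # as"]) simp
  qed
qed

text \<open>At x = i / (n - i) one has n x / (x + 1) = i and x + 1 = n / (n - i). Normalized
  \<open>g\<close> split into factors coming from \<open>KP\<close>, and linearity gives the
  rest.\<close>

lemma poly_Phi_binomial_transform:
  assumes "0 < n" and \<Phi>: "is_Phi n \<Phi>" and "degree g < n" and "i < n"
  shows "poly (\<Phi> (binomial_transform n g)) (of_nat i / of_nat (n - i))
    = (of_nat n / of_nat (n - i)) ^ n * poly g (of_nat i)"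
proof -
  define x q :: complex where "x = of_nat i / of_nat (n - i)" and "q = of_nat n / of_nat (n - i)"
  define T where "T h \<longleftrightarrow> poly (\<Phi> (binomial_transform n h)) x = q ^ n * poly h (of_nat i)" for h
  have nz: "(of_nat n :: complex) \<noteq> 0" "(of_nat (n - i) :: complex) \<noteq> 0"
    using assms by auto
  have normalized: "T h" if h: "degree h < n" "poly h (of_nat n) = 1" for h
  proof -
    have "degree h \<le> n - 1"
      using h by auto
    then obtain as where as: "length as = n - 1" "h = (\<Prod>a\<leftarrow>as. [:a, (1 - a) / of_nat n:])"
      using linear_factors_normalized_at[of h "n - 1" "of_nat n"] h nz by auto
    have "binomial_transform n h = schur_szego_list n (map (KP n) as)"
    proof (rule poly_eqI)
      fix k
      show "coeff (binomial_transform n h) k = coeff (schur_szego_list n (map (KP n) as)) k"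
      proof (cases "k \<le> n")
        case True
        with \<open>0 < n\<close> show ?thesis
          by (simp add: coeff_binomial_transform coeff_schur_szego_list_KP as poly_prod_list_map
              mult.commute)
      next
        case False
        moreover have "coeff (schur_szego_list n Ps) k = 0" if "k > n" for Ps k
          using that by (cases Ps) (auto simp: schur_szego_list_def coeff_schur_szego
              coeff_eq_0 degree_power_eq)
        ultimately show ?thesis
          by (simp add: coeff_binomial_transform)
      qed
    qed
    then have "\<Phi> (binomial_transform n h) = [:1, 1:] * (\<Prod>a\<leftarrow>as. [:a, 1:])"
      using \<Phi> as by (simp add: is_Phi_def)
    then have "poly (\<Phi> (binomial_transform n h)) x = (1 + x) * (\<Prod>a\<leftarrow>as. x + a)"
      by (simp add: poly_prod_list_map add.commute distrib_right)
    moreover have "1 + x = q"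
      using nz \<open>i < n\<close> by (simp add: x_def q_def field_simps of_nat_diff)
    moreover have "x + a = q * (a + (1 - a) / of_nat n * of_nat i)" for a
      using nz \<open>i < n\<close> by (simp add: x_def q_def field_simps of_nat_diff)
    then have "(\<Prod>a\<leftarrow>bs. x + a)
        = q ^ length bs * (\<Prod>a\<leftarrow>bs. a + (1 - a) / of_nat n * of_nat i)" for bs
      by (induction bs) auto
    moreover have "q * (q ^ length as * c) = q ^ n * c" for c
      using \<open>0 < n\<close> as(1) by (simp add: power_eq_if)
    ultimately have "poly (\<Phi> (binomial_transform n h)) x
        = q ^ n * (\<Prod>a\<leftarrow>as. a + (1 - a) / of_nat n * of_nat i)"
      by metis
    then show ?thesis
      by (simp add: T_def as poly_prod_list_map mult.commute)
  qed
  have smult: "T (smult c h)" if "T h" "degree h < n" for c h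
    using \<Phi> that binomial_transform_in_VP[of h n]
    by (simp add: T_def is_Phi_def binomial_transform_smult)
  have add: "T (g + h)" if "T g" "T h" "degree g < n" "degree h < n" for g h
    using \<Phi> that binomial_transform_in_VP[of h n] binomial_transform_in_VP[of g n]
    by (simp add: T_def is_Phi_def binomial_transform_add algebra_simps)
  have nonzero: "T h" if "degree h < n" "poly h (of_nat n) \<noteq> 0" for h
  proof -
    define c where "c = poly h (of_nat n)"
    have "T (smult c (smult (1 / c) h))"
      using that by (intro smult normalized) (auto simp: c_def)
    then show ?thesis
      using that by (simp add: c_def)
  qed
  have "T g"
  proof (cases "poly g (of_nat n) = 0")
    case True
    \<comment> \<open>Both summands are nonzero at \<open>n\<close>, so each can be
      normalized.\<close>
    have "T ((g + 1) + (- 1))"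
      using True assms by (intro add nonzero degree_add_less) auto
    then show ?thesis
      by simp
  qed (use nonzero assms in auto)
  then show ?thesis
    by (simp add: T_def x_def q_def)
qed

text \<open>The previous formula solved for the coefficient. What matters later is that the factor
  is positive. The bound \<open>i < n\<close> keeps the evaluation point finite.\<close>

lemma coeff_via_Phi:
  assumes "0 < n" and \<Phi>: "is_Phi n \<Phi>" and "P \<in> VP n" and "i < n"
  shows "coeff P i = of_nat (n choose i) * (of_nat (n - i) / of_nat n) ^ n
    * poly (\<Phi> P) (of_nat i / of_nat (n - i))"
proof -
  obtain g where g: "degree g < n" "binomial_transform n g = P"
    using binomial_transform_onto_VP assms by blast
  have "(of_nat (n - i) / of_nat n :: complex) ^ n * (of_nat n / of_nat (n - i)) ^ n = 1"
    using assms by (simp flip: power_mult_distrib)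
  then have "(of_nat (n - i) / of_nat n :: complex) ^ n * ((of_nat n / of_nat (n - i)) ^ n * c) = c" for c
    by (metis mult.assoc mult_1)
  then show ?thesis
    using poly_Phi_binomial_transform[OF assms(1,2) g(1) \<open>i < n\<close>] assms
    by (simp add: g coeff_binomial_transform[of n g, unfolded g])
qed

subsection \<open>Sign alternations and positive roots\<close>

text \<open>At least \<open>m\<close> sign changes, witnessed by \<open>m + 1\<close> increasing
  points; \<open>s\<close> fixes the sign at the first one. The order type is general so as to cover
  both coefficient sequences and functions on the reals.\<close>

definition alternates :: "('a::linorder \<Rightarrow> real) \<Rightarrow> 'a set \<Rightarrow> nat \<Rightarrow> bool" where
  "alternates f S m \<longleftrightarrow> (\<exists>s t. strict_mono_on {..m} t \<and>
     (\<forall>i\<le>m. t i \<in> S \<and> 0 < s * (- 1) ^ i * f (t i)))"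

lemma strict_mono_on_atMostI:
  fixes t :: "nat \<Rightarrow> 'a::order"
  assumes "\<And>i. i < m \<Longrightarrow> t i < t (Suc i)"
  shows "strict_mono_on {..m} t"
proof (rule strict_mono_onI)
  fix i k assume "i \<in> {..m}" "k \<in> {..m}" "i < k"
  from \<open>i < k\<close> show "t i < t k"
    using \<open>k \<in> {..m}\<close>
  proof (induction k)
    case (Suc k)
    then show ?case
      using assms[of k] by (cases "i = k") (auto intro: less_trans)
  qed simp
qed

lemma alternates_mono:
  assumes "alternates f S m" and "k \<le> m"
  shows "alternates f S k"
proof -
  from assms(1) obtain s t where "strict_mono_on {..m} t"
    and "\<forall>i\<le>m. t i \<in> S \<and> 0 < s * (- 1) ^ i * f (t i)"
    by (auto simp: alternates_def)
  with \<open>k \<le> m\<close> show ?thesis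
    unfolding alternates_def
    by (intro exI[of _ s] exI[of _ t]) (auto intro: monotone_on_subset)
qed

text \<open>Alternation points never lie at zeros of \<open>f\<close>, so \<open>h\<close> need only
  be controlled off the zeros. Positive factors do not affect signs.\<close>

lemma alternates_transfer:
  assumes "alternates f S m" and "strict_mono_on {x \<in> S. f x \<noteq> 0} h"
    and "\<And>x. x \<in> S \<Longrightarrow> f x \<noteq> 0 \<Longrightarrow> h x \<in> S' \<and> (\<exists>c>0. f x = c * g (h x))"
  shows "alternates g S' m"
proof -
  from assms(1) obtain s t where t: "strict_mono_on {..m} t"
    and *: "\<And>i. i \<le> m \<Longrightarrow> t i \<in> S \<and> 0 < s * (- 1) ^ i * f (t i)"
    by (auto simp: alternates_def)
  have nz: "t i \<in> S \<and> f (t i) \<noteq> 0" if "i \<le> m" for i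
    using *[OF that] by (metis mult_zero_right order_less_irrefl)
  have "strict_mono_on {..m} (h \<circ> t)"
    using nz strict_mono_onD[OF t]
    by (auto intro!: strict_mono_onI strict_mono_onD[OF assms(2)])
  moreover have "0 < s * (- 1) ^ i * g (h (t i))" if "i \<le> m" for i
  proof -
    from nz[OF that] assms(3) obtain c where "c > 0" "f (t i) = c * g (h (t i))"
      by blast
    with *[OF that] show ?thesis
      by (metis mult.left_commute zero_less_mult_pos)
  qed
  ultimately show ?thesis
    unfolding alternates_def using nz assms(3)
    by (intro exI[of _ s] exI[of _ "h \<circ> t"]) auto
qed

text \<open>With \<open>d\<close> the coefficients of \<open>(x - r) * p\<close>, the sum of \<open>d i * r ^ (i - 1)\<close> over
  \<open>a < i \<le> b\<close> telescopes to \<open>p a * r ^ a - p b * r ^ b\<close>, so between two indices of opposite sign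
  of \<open>p\<close> some \<open>d i\<close> has the sign of \<open>p a\<close>; the two ends provide the extra alternation.\<close>

lemma alternates_coeff_linear_mult:
  fixes p :: "real poly"
  assumes "0 < r" and "alternates (coeff p) UNIV m"
  shows "alternates (coeff ([:- r, 1:] * p)) UNIV (Suc m)"
proof -
  define d where "d = coeff ([:- r, 1:] * p)"
  have d_0: "d 0 = - r * coeff p 0" and d_Suc: "d (Suc i) = coeff p i - r * coeff p (Suc i)" for i
    by (simp_all add: d_def)
  have head: "(\<Sum>i\<le>b. d i * r ^ i) = - r * (coeff p b * r ^ b)" for b
    by (induction b) (simp_all add: d_0 d_Suc algebra_simps)
  have tele: "(\<Sum>i\<in>{a<..b}. d i * r ^ i) = r * (coeff p a * r ^ a - coeff p b * r ^ b)" if "a \<le> b" for a b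
  proof -
    have "(\<Sum>i\<le>b. d i * r ^ i) = (\<Sum>i\<le>a. d i * r ^ i) + (\<Sum>i\<in>{a<..b}. d i * r ^ i)"
      using that by (subst sum.union_disjoint[symmetric]) (auto intro: sum.cong)
    then show ?thesis
      by (simp add: head algebra_simps)
  qed
  have pick: "\<exists>i\<in>I. 0 < s * d i" if "0 < s * (\<Sum>i\<in>I. d i * r ^ i)" for s I
  proof (rule ccontr)
    assume "\<not> ?thesis"
    then have "s * (d i * r ^ i) \<le> 0" if "i \<in> I" for i
      using that \<open>0 < r\<close> by (metis mult.assoc mult_nonpos_nonneg not_le zero_le_power less_imp_le)
    then show False
      using that by (metis (no_types, lifting) sum_distrib_left sum_nonpos not_le)
  qed
  from assms(2) obtain s t where t: "strict_mono_on {..m} t"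
    and s: "\<And>i. i \<le> m \<Longrightarrow> 0 < s * (- 1) ^ i * coeff p (t i)"
    by (auto simp: alternates_def)
  have s': "0 < s * (- 1) ^ i * (coeff p (t i) * r ^ t i)" if "i \<le> m" for i
    using mult_pos_pos[OF s[OF that], of "r ^ t i"] \<open>0 < r\<close> by (simp add: mult.assoc)
  \<comment> \<open>The index for \<open>i\<close> is sought between \<open>t (i - 1)\<close> and
    \<open>t i\<close>. These blocks are disjoint and ordered, which makes the choice strictly
    increasing.\<close>
  have "\<exists>k. (i \<le> m \<longrightarrow> k \<le> t i) \<and> (0 < i \<longrightarrow> t (i - 1) < k) \<and> 0 < (- s) * (- 1) ^ i * d k"
    if i: "i \<le> Suc m" for i
  proof (cases i)
    case 0
    have "0 < (- s) * (\<Sum>k\<le>t 0. d k * r ^ k)"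
      using mult_pos_pos[OF \<open>0 < r\<close> s'[of 0]] by (simp add: head mult.left_commute)
    from pick[OF this] show ?thesis
      by (auto simp: 0)
  next
    case (Suc i')
    then have i': "i' \<le> m"
      using i by simp
    \<comment> \<open>The last block has no right end \<open>t i\<close>; it runs past the degree,
      where the coefficient is 0.\<close>
    define b where "b = (if i \<le> m then t i else max (t i') (degree p) + 1)"
    have b: "t i' < b"
      using strict_mono_onD[OF t, of i' i] by (auto simp: b_def Suc)
    have "0 \<le> s * (- 1) ^ i * (coeff p b * r ^ b)"
      using s'[of i] by (auto simp: b_def coeff_eq_0 less_imp_le)
    then have "0 < s * (- 1) ^ i' * (coeff p (t i') * r ^ t i' - coeff p b * r ^ b)"
      using s'[OF i'] by (simp add: Suc algebra_simps)
    then have "0 < s * (- 1) ^ i' * (\<Sum>k\<in>{t i'<..b}. d k * r ^ k)"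
      using \<open>0 < r\<close> b by (simp add: tele mult.left_commute[of _ r])
    from pick[OF this] show ?thesis
      by (auto simp: Suc b_def)
  qed
  then obtain u where u: "\<And>i. i \<le> Suc m \<Longrightarrow> (i \<le> m \<longrightarrow> u i \<le> t i) \<and> (0 < i \<longrightarrow> t (i - 1) < u i)
      \<and> 0 < (- s) * (- 1) ^ i * d (u i)"
    by metis
  have "strict_mono_on {..Suc m} u"
  proof (rule strict_mono_on_atMostI)
    fix i assume "i < Suc m"
    then show "u i < u (Suc i)"
      using u[of i] u[of "Suc i"] by auto
  qed
  then show ?thesis
    unfolding alternates_def d_def[symmetric] using u by blast
qed

text \<open>Descartes' rule of signs for distinct positive roots: each root splits off a linear
  factor, which adds a sign change.\<close>

lemma alternates_coeff_if_pos_roots: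
  fixes p :: "real poly"
  assumes "finite X" and "X \<subseteq> {0<..}" and "p \<noteq> 0" and "\<And>x. x \<in> X \<Longrightarrow> poly p x = 0"
  shows "alternates (coeff p) UNIV (card X)"
  using assms
proof (induction X arbitrary: p rule: finite_induct)
  case empty
  have "0 < lead_coeff p * (- 1) ^ 0 * lead_coeff p"
    using empty.prems by (simp add: zero_less_mult_iff) (metis leading_coeff_neq_0 linorder_cases)
  then show ?case
    unfolding alternates_def
    by (intro exI[of _ "lead_coeff p"] exI[of _ "\<lambda>_. degree p"]) (auto simp: monotone_on_def)
next
  case (insert r X)
  obtain q where q: "p = [:- r, 1:] * q"
    using insert.prems(3)[of r] by (auto simp: poly_eq_0_iff_dvd)
  have "poly q x = 0" if "x \<in> X" for x
    using insert.prems(3)[of x] that insert.hyps by (auto simp: q)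
  then have "alternates (coeff q) UNIV (card X)"
    using insert.prems q by (intro insert.IH) auto
  then show ?case
    using insert.prems insert.hyps by (simp add: q alternates_coeff_linear_mult del: mult_pCons_left)
qed

lemma alternates_nonzero: "alternates (poly p) S m \<Longrightarrow> p \<noteq> 0"
  by (auto simp: alternates_def)

text \<open>The intermediate value theorem gives a root between any two consecutive alternation
  points.\<close>

lemma pos_roots_if_alternates:
  fixes p :: "real poly"
  assumes "alternates (poly p) {0<..} m"
  obtains X where "finite X" "card X = m" "X \<subseteq> {0<..}" "\<And>x. x \<in> X \<Longrightarrow> poly p x = 0"
proof -
  from assms obtain s t where t: "strict_mono_on {..m} t"
    and s: "\<And>i. i \<le> m \<Longrightarrow> 0 < t i \<and> 0 < s * (- 1) ^ i * poly p (t i)"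
    by (auto simp: alternates_def)
  have "\<exists>x. t i < x \<and> x < t (Suc i) \<and> poly p x = 0" if "i < m" for i
  proof -
    have "0 < (s * (- 1) ^ i * poly p (t i)) * (s * (- 1) ^ Suc i * poly p (t (Suc i)))"
      using s[of i] s[of "Suc i"] that by (intro mult_pos_pos[of "s * (- 1) ^ i * poly p (t i)"]) auto
    also have "\<dots> = - ((s * (- 1) ^ i)\<^sup>2 * (poly p (t i) * poly p (t (Suc i))))"
      by (simp add: power2_eq_square algebra_simps)
    finally have "poly p (t i) * poly p (t (Suc i)) < 0"
      by (auto simp: mult_less_0_iff)
    moreover have "t i < t (Suc i)"
      using that by (intro strict_mono_onD[OF t]) auto
    ultimately show ?thesis
      using poly_IVT by blast
  qed
  then obtain x where x: "\<And>i. i < m \<Longrightarrow> t i < x i \<and> x i < t (Suc i) \<and> poly p (x i) = 0"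
    by metis
  have less: "x i < x k" if "i < k" "k < m" for i k
  proof -
    have "t (Suc i) \<le> t k"
      using that t by (auto simp: strict_mono_on_leD)
    with x[of i] x[of k] that show ?thesis
      by linarith
  qed
  have "inj_on x {..<m}"
    by (rule inj_onI) (metis less lessThan_iff linorder_neqE_nat order_less_irrefl)
  then have "card (x ` {..<m}) = m"
    by (simp add: card_image)
  moreover have "x ` {..<m} \<subseteq> {0<..}"
  proof clarsimp
    fix i assume "i < m"
    with x[of i] s[of i] show "0 < x i" by linarith
  qed
  ultimately show ?thesis
    using that[of "x ` {..<m}"] x by auto
qed

text \<open>Division by the square of x - a preserves the signs where \<open>p\<close> is nonzero.
  The quotient would then have \<open>m\<close> roots but degree at most
  \<open>m - 1\<close>.\<close>

lemma no_double_root_if_alternates: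
  fixes p :: "real poly"
  assumes alt: "alternates (poly p) {0<..} m" and deg: "degree p \<le> Suc m"
    and "poly p a = 0" and "poly (pderiv p) a = 0"
  shows False
proof -
  obtain q1 where q1: "p = [:- a, 1:] * q1"
    using \<open>poly p a = 0\<close> by (auto simp: poly_eq_0_iff_dvd)
  have "poly q1 a = 0"
    using assms(4) by (simp add: q1 pderiv_mult pderiv_pCons del: mult_pCons_left)
  then obtain q where q: "q1 = [:- a, 1:] * q"
    by (auto simp: poly_eq_0_iff_dvd)
  have "p \<noteq> 0"
    using alt by (rule alternates_nonzero)
  then have "q \<noteq> 0"
    by (auto simp: q1 q)
  then have degree_p: "degree p = Suc (Suc (degree q))"
    by (simp add: q1 q degree_mult_eq del: mult_pCons_left)
  have p: "poly p x = (x - a)\<^sup>2 * poly q x" for x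
    by (simp add: q1 q power2_eq_square algebra_simps)
  have "alternates (poly q) {0<..} m"
  proof (rule alternates_transfer[OF alt])
    show "strict_mono_on {x \<in> {0<..}. poly p x \<noteq> 0} id"
      by (auto intro: strict_mono_onI)
    show "id x \<in> {0<..} \<and> (\<exists>c>0. poly p x = c * poly q (id x))" if "x \<in> {0<..}" "poly p x \<noteq> 0" for x
      using that by (auto simp: p)
  qed
  then obtain X where X: "finite X" "card X = m" "\<And>x. x \<in> X \<Longrightarrow> poly q x = 0"
    by (rule pos_roots_if_alternates) blast
  have "card X \<le> card {x. poly q x = 0}"
    using X \<open>q \<noteq> 0\<close> by (intro card_mono poly_roots_finite) auto
  also have "\<dots> \<le> degree q"
    using \<open>q \<noteq> 0\<close> by (rule card_poly_roots_bound)
  finally show False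
    using degree_p deg X by linarith
qed

text \<open>By Rolle, applied to \<open>B / A\<close>.\<close>

lemma root_between_if_Wronskian_nonzero:
  fixes A B :: "real poly"
  assumes "a < b" and "poly B a = 0" and "poly B b = 0"
    and W: "\<And>x. a \<le> x \<Longrightarrow> x \<le> b \<Longrightarrow>
      poly A x * poly (pderiv B) x - poly (pderiv A) x * poly B x \<noteq> 0"
  shows "\<exists>x. a < x \<and> x < b \<and> poly A x = 0"
proof (rule ccontr)
  assume "\<not> ?thesis"
  \<comment> \<open>At the end points \<open>B\<close> vanishes, so the Wronskian there is a
    multiple of \<open>A\<close>.\<close>
  moreover have "poly A a \<noteq> 0" "poly A b \<noteq> 0"
    using W[of a] W[of b] assms by auto
  ultimately have nz: "poly A x \<noteq> 0" if "a \<le> x" "x \<le> b" for x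
    using that by (metis order_less_le)
  define f where "f x = poly B x / poly A x" for x
  define f' where "f' x = (poly (pderiv B) x * poly A x - poly B x * poly (pderiv A) x)
    / (poly A x * poly A x)" for x
  have der: "(f has_real_derivative f' x) (at x)" if "a \<le> x" "x \<le> b" for x
    unfolding f_def f'_def by (intro DERIV_divide poly_DERIV nz that)
  have "\<exists>z>a. z < b \<and> DERIV f z :> 0"
  proof (rule Rolle)
    show "continuous_on {a..b} f"
      unfolding f_def using nz by (intro continuous_intros) auto
    show "f differentiable at x" if "a < x" "x < b" for x
      using der[of x] that by (auto simp: real_differentiable_def)
  qed (use assms in \<open>auto simp: f_def\<close>)
  then obtain z where z: "a < z" "z < b" "DERIV f z :> 0"
    by blast
  then have "f' z = 0"
    using der[of z] DERIV_unique by fastforce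
  then show False
    using W[of z] nz[of z] z by (simp add: f'_def algebra_simps)
qed

text \<open>Upward induction from 1 gives one inequality, downward induction from \<open>m\<close>
  the other.\<close>

lemma strict_mono_self_map_interval_eq:
  fixes k :: "nat \<Rightarrow> nat"
  assumes "\<And>i. i \<in> {1..m} \<Longrightarrow> k i \<in> {1..m}"
    and "\<And>i. 1 \<le> i \<Longrightarrow> i < m \<Longrightarrow> k i < k (Suc i)" and "i \<in> {1..m}"
  shows "k i = i"
proof (rule antisym)
  have "1 \<le> i" "i \<le> m"
    using assms by auto
  from \<open>1 \<le> i\<close> \<open>i \<le> m\<close> show "i \<le> k i"
  proof (induction i rule: dec_induct)
    case base
    then show ?case
      using assms(1)[of 1] by auto
  next
    case (step i)
    then show ?case
      using assms(2)[of i] by auto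
  qed
  from \<open>i \<le> m\<close> \<open>1 \<le> i\<close> show "k i \<le> i"
  proof (induction i rule: inc_induct)
    case base
    then show ?case
      using assms(1)[of m] by auto
  next
    case (step i)
    then show ?case
      using assms(2)[of i] by auto
  qed
qed

subsection \<open>Eigenvectors of \<open>\<Phi>\<close>\<close>

lemma map_poly_of_real_add:
  "map_poly of_real (p + q) = map_poly of_real p + (map_poly of_real q :: complex poly)"
  by (rule poly_eqI) (simp add: coeff_map_poly)

lemma map_poly_of_real_smult:
  "map_poly of_real (smult c p) = smult (of_real c) (map_poly of_real p :: complex poly)"
  by (rule poly_eqI) (simp add: coeff_map_poly)

lemma map_poly_of_real_mult:
  "map_poly of_real (p * q) = map_poly of_real p * (map_poly of_real q :: complex poly)"
  by (rule poly_eqI) (simp add: coeff_map_poly coeff_mult)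

lemma map_poly_of_real_power:
  "map_poly of_real (p ^ k) = (map_poly of_real p :: complex poly) ^ k"
  by (induction k) (simp_all add: map_poly_of_real_mult)

lemma poly_map_poly_of_real:
  "poly (map_poly of_real p) (of_real x) = (of_real (poly p x) :: complex)"
  by (induction p) (simp_all add: map_poly_pCons)

text \<open>Descartes' rule gives sign changes of the coefficients of \<open>p\<close>, which are
  positive multiples of values of \<open>q\<close>. Only indices strictly between 0 and
  \<open>n\<close> carry nonzero coefficients, so all evaluation points are positive and
  finite.\<close>

lemma alternates_Phi:
  assumes "0 < n" and \<Phi>: "is_Phi n \<Phi>" and "map_poly of_real p \<in> VP n"
    and \<Phi>_p: "\<Phi> (map_poly of_real p) = map_poly of_real q"
    and "degree p < n" and "coeff p 0 = 0" and "p \<noteq> 0"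
    and "finite X" and "X \<subseteq> {0<..}" and "\<And>x. x \<in> X \<Longrightarrow> poly p x = 0"
  shows "alternates (poly q) {0<..} (card X)"
proof (rule alternates_transfer[where h = "\<lambda>i. real i / real (n - i)"])
  show "alternates (coeff p) UNIV (card X)"
    using assms by (intro alternates_coeff_if_pos_roots)
  have range: "0 < i \<and> i < n" if "coeff p i \<noteq> 0" for i
    using that assms le_degree[of p i] by (cases i) auto
  then show "strict_mono_on {i \<in> UNIV. coeff p i \<noteq> 0} (\<lambda>i. real i / real (n - i))"
    by (auto intro!: strict_mono_onI frac_less diff_le_mono2)
  fix i assume "coeff p i \<noteq> 0"
  with range have i: "0 < i" "i < n"
    by auto
  define c where "c = real (n choose i) * (real (n - i) / real n) ^ n"
  have "complex_of_real (coeff p i) = complex_of_real (c * poly q (real i / real (n - i)))"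
    using coeff_via_Phi[OF assms(1-3) \<open>i < n\<close>]
      poly_map_poly_of_real[of q "real i / real (n - i)"]
    by (simp add: \<Phi>_p coeff_map_poly c_def)
  then have "coeff p i = c * poly q (real i / real (n - i))"
    by (simp only: of_real_eq_iff)
  moreover have "c > 0"
    using i by (simp add: c_def)
  ultimately show "real i / real (n - i) \<in> {0<..}
      \<and> (\<exists>c>0. coeff p i = c * poly q (real i / real (n - i)))"
    using i by auto
qed

lemma is_Phi_add:
  "is_Phi n \<Phi> \<Longrightarrow> p \<in> VP n \<Longrightarrow> q \<in> VP n \<Longrightarrow> \<Phi> (p + q) = \<Phi> p + \<Phi> q"
  by (simp add: is_Phi_def)

lemma is_Phi_smult: "is_Phi n \<Phi> \<Longrightarrow> p \<in> VP n \<Longrightarrow> \<Phi> (smult c p) = smult c (\<Phi> p)"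
  by (simp add: is_Phi_def)

lemma VP_add: "p \<in> VP n \<Longrightarrow> q \<in> VP n \<Longrightarrow> p + q \<in> VP n"
  by (simp add: VP_def degree_add_le)

lemma VP_smult: "p \<in> VP n \<Longrightarrow> smult c p \<in> VP n"
  by (auto simp: VP_def intro: order.trans[OF degree_smult_le])

text \<open>Alternation is a finite set of strict inequalities, hence stable under a perturbation
  tending to 0.\<close>

lemma alternates_add_small:
  fixes r :: real
  assumes "alternates (poly p) S m" and "0 \<le> r" "r < 1"
  shows "\<exists>k. alternates (poly (p + smult (d * r ^ k) q)) S m"
proof -
  from assms(1) obtain s t where t: "strict_mono_on {..m} t"
    and s: "\<And>i. i \<le> m \<Longrightarrow> t i \<in> S \<and> 0 < s * (- 1) ^ i * poly p (t i)"
    by (auto simp: alternates_def)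
  have "\<forall>\<^sub>F k in sequentially. \<forall>i\<in>{..m}. 0 < s * (- 1) ^ i * poly (p + smult (d * r ^ k) q) (t i)"
  proof (rule eventually_ball_finite)
    show "\<forall>i\<in>{..m}. \<forall>\<^sub>F k in sequentially.
      0 < s * (- 1) ^ i * poly (p + smult (d * r ^ k) q) (t i)"
    proof
      fix i assume "i \<in> {..m}"
      have "(\<lambda>k. s * (- 1) ^ i * (poly p (t i) + d * r ^ k * poly q (t i)))
          \<longlonglongrightarrow> s * (- 1) ^ i * (poly p (t i) + d * 0 * poly q (t i))"
        using assms by (intro tendsto_intros LIMSEQ_realpow_zero) auto
      then show "\<forall>\<^sub>F k in sequentially. 0 < s * (- 1) ^ i * poly (p + smult (d * r ^ k) q) (t i)"
        using s[of i] \<open>i \<in> {..m}\<close> by (intro order_tendstoD) auto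
    qed
  qed simp
  then obtain k where "\<forall>i\<in>{..m}. 0 < s * (- 1) ^ i * poly (p + smult (d * r ^ k) q) (t i)"
    by (auto simp: eventually_sequentially)
  with s t show ?thesis
    unfolding alternates_def by (intro exI[of _ k] exI[of _ s] exI[of _ t]) auto
qed

lemma alternates_smult_iff:
  assumes "c \<noteq> 0"
  shows "alternates (poly (smult c p)) S m \<longleftrightarrow> alternates (poly p) S m"
proof -
  have *: "alternates (poly (smult c p)) S m" if "alternates (poly p) S m" "c \<noteq> 0" for c p
  proof -
    from that(1) obtain s t where "strict_mono_on {..m} t"
      "\<forall>i\<le>m. t i \<in> S \<and> 0 < s * (- 1) ^ i * poly p (t i)"
      by (auto simp: alternates_def)
    then show ?thesis
      unfolding alternates_def using \<open>c \<noteq> 0\<close>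
      by (intro exI[of _ "s / c"] exI[of _ t]) auto
  qed
  from *[of p c] *[of "smult c p" "1 / c"] assms show ?thesis
    by auto
qed

text \<open>\<open>\<Phi>\<close> does not decrease the number of sign changes on the positive axis (Descartes), and
  \<open>\<Phi>\<^sup>k\<close> maps \<open>e + d (l / l')\<^sup>k e'\<close> to a multiple of \<open>e + d e'\<close>. For large \<open>k\<close> the former
  has the sign changes of \<open>e\<close>.\<close>

lemma alternates_add_eigenvector:
  fixes e e' :: "real poly"
  assumes "0 < n" and \<Phi>: "is_Phi n \<Phi>"
    and e: "map_poly of_real e \<in> VP n" "degree e < n" "coeff e 0 = 0"
      "\<Phi> (map_poly of_real e) = smult (of_real l) (map_poly of_real e)"
    and e': "map_poly of_real e' \<in> VP n" "degree e' < n" "coeff e' 0 = 0"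
      "\<Phi> (map_poly of_real e') = smult (of_real l') (map_poly of_real e')"
    and l: "0 < l" "l < l'" and alt: "alternates (poly e) {0<..} m"
  shows "alternates (poly (e + smult d e')) {0<..} m"
proof -
  \<comment> \<open>The coefficient is chosen so that \<open>\<Phi>\<close> sends
    \<open>u (Suc k)\<close> to \<open>l\<close> times \<open>u k\<close>.\<close>
  define u where "u k = e + smult (d * (l / l') ^ k) e'" for k
  have \<Phi>_u: "\<Phi> (map_poly of_real (u (Suc k))) = map_poly of_real (smult l (u k))" for k
    using l unfolding u_def
    by (simp add: map_poly_of_real_add map_poly_of_real_smult is_Phi_add[OF \<Phi>] is_Phi_smult[OF \<Phi>]
        VP_smult e e' smult_add_right mult_ac)
  have step: "alternates (poly (u k)) {0<..} m" if "alternates (poly (u (Suc k))) {0<..} m" for k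
  proof -
    from that obtain X where X: "finite X" "card X = m" "X \<subseteq> {0<..}"
      "\<And>x. x \<in> X \<Longrightarrow> poly (u (Suc k)) x = 0"
      by (rule pos_roots_if_alternates) blast
    have "map_poly of_real (u (Suc k)) \<in> VP n"
      by (simp add: u_def map_poly_of_real_add map_poly_of_real_smult VP_add VP_smult e e')
    moreover have "degree (u (Suc k)) < n"
      unfolding u_def
      by (intro degree_add_less e le_less_trans[OF degree_smult_le] e')
    moreover have "coeff (u (Suc k)) 0 = 0"
      by (simp add: u_def e e')
    ultimately have "alternates (poly (smult l (u k))) {0<..} (card X)"
      using alternates_nonzero[OF that] X
      by (intro alternates_Phi[OF \<open>0 < n\<close> \<Phi> _ \<Phi>_u]) auto
    with X l show ?thesis
      by (simp add: alternates_smult_iff)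
  qed
  obtain k where "alternates (poly (u k)) {0<..} m"
    using alternates_add_small[OF alt, of "l / l'" d e'] l by (auto simp: u_def)
  then have "alternates (poly (u 0)) {0<..} m"
    by (induction k) (use step in auto)
  then show ?thesis
    by (simp add: u_def)
qed

text \<open>The quotient of the two eigenvalues is n / (n - j - 2), which exceeds 1.\<close>

lemma eigval_real_properties:
  assumes "j + 4 \<le> n"
  obtains l l' :: real where "eigval n j = of_real l" "eigval n (j + 1) = of_real l'" "0 < l" "l < l'"
proof -
  define l where "l k = real n ^ (k + 1) / (\<Prod>i=1..k+1. real n - real i)" for k
  have "eigval n k = of_real (l k)" for k
    by (simp add: eigval_def l_def)
  moreover have pos: "0 < l j"
    unfolding l_def using assms by (intro divide_pos_pos prod_pos) auto
  moreover have "l (j + 1) = l j * (real n / (real n - real (j + 2)))"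
    by (simp add: l_def)
  then have "l j < l (j + 1)"
    using assms pos by (simp add: less_divide_eq)
  ultimately show ?thesis
    using that by blast
qed

text \<open>The spanning vector from \<open>is_Q\<close>, kept over the reals so that signs make
  sense.\<close>

definition eigenpoly :: "nat \<Rightarrow> nat \<Rightarrow> real poly \<Rightarrow> real poly" where
  "eigenpoly n j Q = [:0, 1:] * [:1, 1:] ^ (n - 2 - j) * Q"

lemma is_Q_eigenpoly:
  assumes "is_Q n \<Phi> j Q" and "j + 3 \<le> n"
  shows "map_poly of_real (eigenpoly n j Q) \<in> VP n"
    and "\<Phi> (map_poly of_real (eigenpoly n j Q)) = smult (eigval n j) (map_poly of_real (eigenpoly n j Q))"
    and "degree (eigenpoly n j Q) < n" and "coeff (eigenpoly n j Q) 0 = 0"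
    and "eigenpoly n j Q \<noteq> 0"
proof -
  let ?E = "[:0, 1:] * [:1, 1:] ^ (n - 2 - j) * map_poly of_real Q :: complex poly"
  have "smult 1 ?E \<in> eigenspace n \<Phi> (eigval n j)"
    using assms unfolding is_Q_def by blast
  moreover have "map_poly of_real (eigenpoly n j Q) = ?E"
    by (simp add: eigenpoly_def map_poly_of_real_mult map_poly_of_real_power map_poly_pCons
        del: mult_pCons_left)
  ultimately show "map_poly of_real (eigenpoly n j Q) \<in> VP n"
    and "\<Phi> (map_poly of_real (eigenpoly n j Q)) = smult (eigval n j) (map_poly of_real (eigenpoly n j Q))"
    by (simp_all add: eigenspace_def)
  have "Q \<noteq> 0"
    using assms by (auto simp: is_Q_def)
  then have "degree (eigenpoly n j Q) = n - 1"
    using assms by (simp add: eigenpoly_def is_Q_def degree_mult_eq degree_power_eq del: mult_pCons_left)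
  with assms show "degree (eigenpoly n j Q) < n"
    by simp
  show "coeff (eigenpoly n j Q) 0 = 0"
    by (simp add: eigenpoly_def)
  show "eigenpoly n j Q \<noteq> 0"
    using \<open>Q \<noteq> 0\<close> by (simp add: eigenpoly_def del: mult_pCons_left)
qed

text \<open>Roots of \<open>Q\<close> are roots of the eigenvector, and \<open>\<Phi>\<close> only
  rescales it, so \<open>alternates_Phi\<close> turns its positive roots into sign changes of
  itself.\<close>

lemma alternates_eigenpoly:
  assumes "is_Phi n \<Phi>" and "is_Q n \<Phi> j Q" and "j + 3 \<le> n"
    and "eigval n j = of_real l" and "l \<noteq> 0"
    and X: "finite X" "X \<subseteq> {0<..}" "\<And>x. x \<in> X \<Longrightarrow> poly Q x = 0"
  shows "alternates (poly (eigenpoly n j Q)) {0<..} (card X)"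
proof -
  note E = is_Q_eigenpoly[OF assms(2,3)]
  have "\<Phi> (map_poly of_real (eigenpoly n j Q)) = map_poly of_real (smult l (eigenpoly n j Q))"
    using E assms by (simp add: map_poly_of_real_smult)
  moreover have "poly (eigenpoly n j Q) x = 0" if "x \<in> X" for x
    using X that by (simp add: eigenpoly_def)
  ultimately have "alternates (poly (smult l (eigenpoly n j Q))) {0<..} (card X)"
    using assms(3) by (intro alternates_Phi[OF _ assms(1) E(1) _ E(3-5) X(1,2)]) auto
  with \<open>l \<noteq> 0\<close> show ?thesis
    by (simp add: alternates_smult_iff)
qed

section \<open>Interlacing of the roots\<close>

theorem theorem3:
  fixes n j :: nat
    and \<Phi> :: "complex poly \<Rightarrow> complex poly"
    and Q Q' :: "real poly"
    and x y :: "nat \<Rightarrow> real"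
  assumes "0 < n" and "1 \<le> j" and "j + 4 \<le> n"
    and "is_Phi n \<Phi>"
    and "is_Q n \<Phi> j Q" and "is_Q n \<Phi> (j + 1) Q'"
    and "{r. poly Q r = 0} = x ` {1..j}"
    and "strict_mono_on {1..j} x" and "0 < x 1"
    and "{r. poly Q' r = 0} = y ` {1..j + 1}"
    and "strict_mono_on {1..j + 1} y" and "0 < y 1"
  shows "\<forall>i\<in>{1..j}. y i < x i \<and> x i < y (i + 1)"
proof -
  obtain l l' where l: "eigval n j = of_real l" "eigval n (j + 1) = of_real l'" "0 < l" "l < l'"
    using eigval_real_properties assms by blast
  have pos: "0 < x i" if "i \<in> {1..j}" for i
    using strict_mono_on_leD[OF assms(8), of 1 i] that assms(9) by auto
  have pos': "0 < y i" if "i \<in> {1..j + 1}" for i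
    using strict_mono_on_leD[OF assms(11), of 1 i] that assms(12) by auto
  define e e' where "e = eigenpoly n j Q" and "e' = eigenpoly n (j + 1) Q'"
  have j3: "j + 3 \<le> n" "j + 1 + 3 \<le> n"
    using assms by auto
  note E = is_Q_eigenpoly[OF assms(5) j3(1), folded e_def]
  note E' = is_Q_eigenpoly[OF assms(6) j3(2), folded e'_def]
  have "alternates (poly e) {0<..} (card (x ` {1..j}))"
    unfolding e_def using l assms(7) pos
    by (intro alternates_eigenpoly[OF assms(4,5) j3(1) l(1)]) auto
  then have alt_e: "alternates (poly e) {0<..} j"
    using assms(8) by (simp add: card_image strict_mono_on_imp_inj_on)
  have "alternates (poly e') {0<..} (card (y ` {1..j + 1}))"
    unfolding e'_def using l assms(10) pos'
    by (intro alternates_eigenpoly[OF assms(4,6) j3(2) l(2)]) auto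
  \<comment> \<open>One sign change is given up so that \<open>e\<close> and \<open>e'\<close> share
    the count \<open>j\<close>.\<close>
  then have alt_e': "alternates (poly e') {0<..} j"
    using assms(11) by (auto simp: card_image strict_mono_on_imp_inj_on intro: alternates_mono)
  \<comment> \<open>\<open>e\<close> and \<open>e'\<close> share the factor x (x + 1)^(n - 3 - j),
    positive for x > 0; the cofactors are \<open>A\<close> and \<open>Q'\<close>.\<close>
  define A where "A = [:1, 1:] * Q"
  have no_double: "False"
    if "c \<noteq> 0 \<or> d \<noteq> 0" "poly (smult c A + smult d Q') a = 0"
      "poly (pderiv (smult c A + smult d Q')) a = 0" for c d a
  proof -
    let ?G = "smult c A + smult d Q'"
    have "alternates (poly (smult c e + smult d e')) {0<..} j"
    proof (cases "c = 0")
      case True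
      with that alt_e' show ?thesis
        by (simp add: alternates_smult_iff)
    next
      case False
      have "alternates (poly (e + smult (d / c) e')) {0<..} j"
        by (rule alternates_add_eigenvector[OF assms(1,4) E(1,3,4) E(2)[unfolded l(1)]
              E'(1,3,4) E'(2)[unfolded l(2)] l(3,4) alt_e])
      with False have "alternates (poly (smult c (e + smult (d / c) e'))) {0<..} j"
        by (simp add: alternates_smult_iff)
      with False show ?thesis
        by (simp add: smult_add_right)
    qed
    then have "alternates (poly ?G) {0<..} j"
    proof (rule alternates_transfer)
      show "strict_mono_on {r \<in> {0<..}. poly (smult c e + smult d e') r \<noteq> 0} id"
        by (auto intro: strict_mono_onI)
      have "n - 2 - j = Suc (n - 2 - (j + 1))"
        using assms(3) by simp
      then have e: "e = [:0, 1:] * [:1, 1:] ^ (n - 2 - (j + 1)) * A"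
        by (simp only: e_def eigenpoly_def A_def power_Suc2 mult.assoc)
      fix r :: real assume "r \<in> {0<..}"
      then show "id r \<in> {0<..} \<and> (\<exists>b>0. poly (smult c e + smult d e') r = b * poly ?G (id r))"
        by (intro conjI exI[of _ "r * (1 + r) ^ (n - 2 - (j + 1))"])
          (auto simp: e e'_def eigenpoly_def algebra_simps simp del: mult_pCons_left)
    qed
    moreover have "degree A \<le> Suc j" "degree Q' \<le> Suc j"
      using assms(5,6) degree_mult_le[of "[:1, 1:]" Q] by (auto simp: A_def is_Q_def simp del: mult_pCons_left)
    then have "degree ?G \<le> Suc j"
      by (intro degree_add_le order.trans[OF degree_smult_le])
    ultimately show False
      using that no_double_root_if_alternates by blast
  qed
  \<comment> \<open>A zero of the Wronskian at \<open>a\<close> makes the combination of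
    \<open>A\<close> and \<open>Q'\<close> vanishing at \<open>a\<close> have a double root there,
    so both vanish at \<open>a\<close>. The combination cancelling the derivatives then forces
    \<open>A\<close> itself to have a double root.\<close>
  have W: "poly A a * poly (pderiv Q') a - poly (pderiv A) a * poly Q' a \<noteq> 0" for a
  proof
    assume W0: "poly A a * poly (pderiv Q') a - poly (pderiv A) a * poly Q' a = 0"
    have "poly A a = 0 \<and> poly Q' a = 0"
      using no_double[of "poly Q' a" "- poly A a" a] W0
      by (auto simp: pderiv_add pderiv_diff pderiv_smult algebra_simps)
    moreover from this have "poly (pderiv A) a = 0"
      using no_double[of "poly (pderiv Q') a" "- poly (pderiv A) a" a]
      by (auto simp: pderiv_add pderiv_diff pderiv_smult)
    ultimately show False
      using no_double[of 1 0 a] by simp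
  qed
  have "\<exists>k\<in>{1..j}. y i < x k \<and> x k < y (Suc i)" if "i \<in> {1..j}" for i
  proof -
    have "y i < y (Suc i)"
      using that by (intro strict_mono_onD[OF assms(11)]) auto
    moreover have "poly Q' (y i) = 0" "poly Q' (y (Suc i)) = 0"
      using assms(10) that by auto
    ultimately obtain r where r: "y i < r" "r < y (Suc i)" "poly A r = 0"
      using root_between_if_Wronskian_nonzero W by blast
    moreover have "0 < y i"
      using that pos' by auto
    \<comment> \<open>Positivity of \<open>r\<close> excludes the extra root -1 of
      \<open>A\<close>.\<close>
    ultimately have "(1 + r) * poly Q r = 0" "0 < r"
      by (auto simp: A_def algebra_simps)
    then have "poly Q r = 0"
      by auto
    then have "r \<in> x ` {1..j}"
      using assms(7) by blast
    then show ?thesis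
      using r by blast
  qed
  then obtain k where k: "\<And>i. i \<in> {1..j} \<Longrightarrow> k i \<in> {1..j} \<and> y i < x (k i) \<and> x (k i) < y (Suc i)"
    by metis
  \<comment> \<open>The gaps between consecutive \<open>y i\<close> are ordered, so \<open>k\<close>
    is strictly increasing on \<open>{1..j}\<close> and must be the identity.\<close>
  have "k i = i" if "i \<in> {1..j}" for i
  proof (rule strict_mono_self_map_interval_eq[OF _ _ that])
    fix i assume i: "1 \<le> i" "i < j"
    then have "x (k i) < x (k (Suc i))"
      using k[of i] k[of "Suc i"] by auto
    then show "k i < k (Suc i)"
      using strict_mono_on_leD[OF assms(8), of "k (Suc i)" "k i"] k[of i] k[of "Suc i"] i
      by (meson atLeastAtMost_iff less_imp_le not_le Suc_leI le_SucI)
  qed (use k in auto)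
  with k show ?thesis
    by auto
qed

end
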